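(* Let $n\ge1$ and let $f_5:\mathbb{C}_2^{\,n}\times\mathbb{C}_2^{\,n}\to\mathbb{C}_1$ be defined, for $P=(\xi_1,\dots,\xi_n)$ and $Q=(\eta_1,\dots,\eta_n)$ with $\xi_k={}^kz_1+i_2\,{}^kz_2$ and $\eta_k={}^kw_1+i_2\,{}^kw_2$ (all ${}^kz_j,{}^kw_j\in\mathbb{C}_1$), by $$f_5(P,Q)=\sum_{k=1}^n\left({}^kz_1\,\overline{{}^kw_1}+{}^kz_2\,\overline{{}^kw_2}\right).$$ Then: (a) $f_5(P,P)\ge0$ for all $P\in\mathbb{C}_2^{\,n}$; (b) $f_5(P,P)=0$ if and only if $P=0$; (c) $\overline{f_5(Q,P)}=f_5(P,Q)$ for all $P,Q\in\mathbb{C}_2^{\,n}$; (d) $f_5(P+Q,R)=f_5(P,R)+f_5(Q,R)$ for all $P,Q,R\in\mathbb{C}_2^{\,n}$; (e) $f_5(\alpha P,Q)=\alpha f_5(P,Q)$ for all $P,Q\in\mathbb{C}_2^{\,n}$ and all $\alpha\in\mathbb{C}_1$.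
   Context: $\mathbb{C}_0$ is the set of real numbers and $\mathbb{C}_1=\{a+i_1b: a,b\in\mathbb{C}_0\}$ the set of complex numbers, with complex conjugation written $\overline{\,\cdot\,}$. $\mathbb{C}_2$ is the set of bicomplex numbers $\xi=x_1+i_1x_2+i_2x_3+i_1i_2x_4$ with $x_1,\dots,x_4$ real, where $i_1^2=i_2^2=-1$ and $i_1i_2=i_2i_1$; it is a commutative algebra over $\mathbb{C}_1$ and over $\mathbb{C}_0$. Equivalently, and uniquely, $\xi=z_1+i_2z_2$ with $z_1=x_1+i_1x_2$, $z_2=x_3+i_1x_4\in\mathbb{C}_1$, and for $\alpha\in\mathbb{C}_1$, $\alpha\xi=\alpha z_1+i_2\,\alpha z_2$. $\mathbb{C}_2^{\,n}$ is the set of $n$-tuples of bicomplex numbers, with componentwise addition and $\alpha P=(\alpha\xi_1,\dots,\alpha\xi_n)$ for $\alpha\in\mathbb{C}_1$. For a complex-valued expression, "$\ge 0$" means that it is a nonnegative real number. *)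

theory Defs
  imports "HOL-Analysis.Analysis"
begin

(* The bicomplex number z1 + i2 z2 is stored as the pair (z1, z2) of complex numbers; the complex
   unit of HOL plays the role of i1.  The lemmas after the instances justify this reading. *)
datatype bicomplex = Bicomplex (bc1: complex) (bc2: complex)

lemma bicomplex_eq_iff: "x = y \<longleftrightarrow> bc1 x = bc1 y \<and> bc2 x = bc2 y"
  by (cases x; cases y) simp

instantiation bicomplex :: comm_ring_1
begin

definition "0 = Bicomplex 0 0"
definition "1 = Bicomplex 1 0"
definition "x + y = Bicomplex (bc1 x + bc1 y) (bc2 x + bc2 y)"
definition "- x = Bicomplex (- bc1 x) (- bc2 x)"
definition "x - y = Bicomplex (bc1 x - bc1 y) (bc2 x - bc2 y)"
definition "x * y =
  Bicomplex (bc1 x * bc1 y - bc2 x * bc2 y) (bc1 x * bc2 y + bc2 x * bc1 y)"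

instance
  by intro_classes
    (simp_all add: bicomplex_eq_iff zero_bicomplex_def one_bicomplex_def plus_bicomplex_def
      uminus_bicomplex_def minus_bicomplex_def times_bicomplex_def algebra_simps)

end

instantiation bicomplex :: real_algebra_1
begin

definition "r *\<^sub>R x = Bicomplex (r *\<^sub>R bc1 x) (r *\<^sub>R bc2 x)"

instance
  by intro_classes
    (simp_all add: bicomplex_eq_iff scaleR_bicomplex_def plus_bicomplex_def times_bicomplex_def
      algebra_simps)

end

definition of_complex :: "complex \<Rightarrow> bicomplex" where
  "of_complex z = Bicomplex z 0"

definition bc_i1 :: bicomplex where
  "bc_i1 = of_complex \<i>"

definition bc_i2 :: bicomplex where
  "bc_i2 = Bicomplex 0 1"

definition bc_scale :: "complex \<Rightarrow> bicomplex \<Rightarrow> bicomplex"  (infixr "*\<^sub>C" 75) where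
  "\<alpha> *\<^sub>C x = Bicomplex (\<alpha> * bc1 x) (\<alpha> * bc2 x)"

lemmas bicomplex_defs =
  zero_bicomplex_def one_bicomplex_def plus_bicomplex_def uminus_bicomplex_def
  minus_bicomplex_def times_bicomplex_def scaleR_bicomplex_def of_complex_def
  bc_i1_def bc_i2_def bc_scale_def

lemma bc_i1_sq: "bc_i1 * bc_i1 = - 1"
  and bc_i2_sq: "bc_i2 * bc_i2 = - 1"
  by (simp_all add: bicomplex_defs)

lemma bicomplex_decomp: "x = of_complex z1 + bc_i2 * of_complex z2 \<longleftrightarrow> z1 = bc1 x \<and> z2 = bc2 x"
  by (auto simp: bicomplex_eq_iff bicomplex_defs)

lemma bicomplex_real_decomp:
  "x = of_real x1 + bc_i1 * of_real x2 + bc_i2 * of_real x3 + bc_i1 * bc_i2 * of_real x4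
   \<longleftrightarrow> bc1 x = Complex x1 x2 \<and> bc2 x = Complex x3 x4"
  by (auto simp: of_real_def bicomplex_eq_iff bicomplex_defs complex_eq_iff)

lemma bc_scale_eq_mult: "\<alpha> *\<^sub>C x = of_complex \<alpha> * x"
  by (simp add: bicomplex_defs)

lemma vector_space_bc_scale: "vector_space bc_scale"
  by standard (simp_all add: bicomplex_defs algebra_simps)

definition bc_vscale :: "complex \<Rightarrow> bicomplex ^ 'n \<Rightarrow> bicomplex ^ 'n"  (infixr "*\<^sub>V" 75) where
  "\<alpha> *\<^sub>V P = (\<chi> k. \<alpha> *\<^sub>C (P $ k))"

definition f5 :: "bicomplex ^ 'n \<Rightarrow> bicomplex ^ 'n \<Rightarrow> complex" where
  "f5 P Q = (\<Sum>k\<in>UNIV. bc1 (P $ k) * cnj (bc1 (Q $ k)) + bc2 (P $ k) * cnj (bc2 (Q $ k)))"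

end

theory Submission
  imports Defs
begin

text \<open>
  Splitting every bicomplex coordinate into its two complex components identifies \<open>n\<close>-tuples of
  bicomplex numbers with vectors of \<open>2n\<close> complex numbers, and \<open>f5\<close> becomes the standard Hermitian
  inner product there. On the diagonal it is therefore the sum of the squared moduli of all \<open>2n\<close>
  components, a real number that is nonnegative and vanishes only when every component does
  (\<open>f5_self\<close>, \<open>f5_self_eq_0_iff\<close>). The algebraic laws hold for each summand: conjugation is an
  involutive ring homomorphism, and addition and complex scaling of bicomplex numbers act on the
  two components separately.
\<close>

lemma f5_self:
  "f5 P P = of_real (\<Sum>k\<in>UNIV. (cmod (bc1 (P $ k)))\<^sup>2 + (cmod (bc2 (P $ k)))\<^sup>2)"
  by (simp add: f5_def flip: complex_norm_square)

lemma f5_self_nonneg: "f5 P P \<in> \<real>\<^sub>\<ge>\<^sub>0"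
  unfolding f5_self nonneg_Reals_of_real_iff by (intro sum_nonneg) simp

lemma f5_self_eq_0_iff: "f5 P P = 0 \<longleftrightarrow> P = 0"
  unfolding f5_self of_real_eq_0_iff
  by (subst sum_nonneg_eq_0_iff)
    (auto simp: sum_power2_eq_zero_iff vec_eq_iff bicomplex_eq_iff zero_bicomplex_def)

lemma cnj_f5: "cnj (f5 Q P) = f5 P Q"
  by (simp add: f5_def mult.commute)

lemma f5_add_left: "f5 (P + Q) R = f5 P R + f5 Q R"
  by (simp add: f5_def plus_bicomplex_def sum.distrib algebra_simps)

lemma f5_scale_left: "f5 (\<alpha> *\<^sub>V P) Q = \<alpha> * f5 P Q"
  by (simp add: f5_def bc_vscale_def bc_scale_def sum_distrib_left algebra_simps)

theorem theorem2p18: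
  shows "(\<forall>P :: bicomplex ^ 'n. f5 P P \<in> \<real>\<^sub>\<ge>\<^sub>0)
    \<and> (\<forall>P :: bicomplex ^ 'n. f5 P P = 0 \<longleftrightarrow> P = 0)
    \<and> (\<forall>P Q :: bicomplex ^ 'n. cnj (f5 Q P) = f5 P Q)
    \<and> (\<forall>P Q R :: bicomplex ^ 'n. f5 (P + Q) R = f5 P R + f5 Q R)
    \<and> (\<forall>(P :: bicomplex ^ 'n) Q (\<alpha> :: complex). f5 (\<alpha> *\<^sub>V P) Q = \<alpha> * f5 P Q)"
  by (simp add: f5_self_nonneg f5_self_eq_0_iff cnj_f5 f5_add_left f5_scale_left)

end
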